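(* Let $X\subseteq\mathbb{Z}^2\setminus\{O\}$ be an arbitrary step set, and let $\mathcal{C}$ be a submonoid of $\mathbb{Z}^2$. Then $\mathcal{A}_X^{\mathcal{C}}$ is a non-trivial group if and only if $O$ belongs to the relative interior of $\operatorname{Conv}(\mathcal{A}_X^{\mathcal{C}}\setminus\{O\})$.
   Context: Write $O=(0,0)$. A step set is any (finite or infinite) subset $X$ of $\mathbb{Z}^2\setminus\{O\}$. $\mathcal{F}_X$ is the free monoid on $X$ (all finite words over $X$, including the empty word), with $\ell(w)$ the length of $w$; for $w=A_1\cdots A_k\in\mathcal{F}_X$ put $\alpha_X(w)=A_1+\cdots+A_k$ and, for $0\le m\le k$, $\sigma_m(w)=A_1\cdots A_m$. For a submonoid $\mathcal{C}$ of $\mathbb{Z}^2$, define $\mathcal{F}_X^{\mathcal{C}}=\{w\in\mathcal{F}_X:\alpha_X(\sigma_m(w))\in\mathcal{C}\text{ for all }0\le m\le\ell(w)\}$ and $\mathcal{A}_X^{\mathcal{C}}=\alpha_X(\mathcal{F}_X^{\mathcal{C}})$, which is a submonoid of $\mathbb{Z}^2$. $\operatorname{Conv}$ denotes convex hull in $\mathbb{R}^2$. The relative interior of a subset $U\subseteq\mathbb{R}^2$ is its interior relative to the smallest affine subspace of $\mathbb{R}^2$ containing $U$ (the relative interior of the empty set is empty). *)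

theory Defs
  imports "HOL-Analysis.Analysis" "HOL-Algebra.Group"
begin

definition Z2 :: "(int \<times> int) monoid" where
  "Z2 = \<lparr>carrier = UNIV, mult = (+), one = 0\<rparr>"

text \<open>Words over \<open>X\<close> are the lists in \<^term>\<open>lists X\<close>, and the prefix
  \<open>\<sigma>\<^sub>m(w)\<close> is \<^term>\<open>take m w\<close>.\<close>

definition alpha :: "(int \<times> int) list \<Rightarrow> int \<times> int" where
  "alpha w = sum_list w"

definition constrained_words :: "(int \<times> int) set \<Rightarrow> (int \<times> int) set \<Rightarrow> (int \<times> int) list set" where
  "constrained_words C X = {w \<in> lists X. \<forall>m\<le>length w. alpha (take m w) \<in> C}"

definition constrained_endpoints :: "(int \<times> int) set \<Rightarrow> (int \<times> int) set \<Rightarrow> (int \<times> int) set" where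
  "constrained_endpoints C X = alpha ` constrained_words C X"

definition embed_R2 :: "int \<times> int \<Rightarrow> real \<times> real" where
  "embed_R2 p = (of_int (fst p), of_int (snd p))"

end

theory Submission imports Defs begin

text \<open>
  For a group, the convex hull of the non-zero elements is symmetric about the origin, hence
  contains the origin in its relative interior. Conversely, if the origin is in the relative
  interior, each non-zero element \<open>x\<close> occurs with positive coefficient in a relation
  \<open>\<Sum>i. c\<^sub>i s\<^sub>i = 0\<close> with real \<open>c\<^sub>i \<ge> 0\<close> and non-zero elements \<open>s\<^sub>i\<close>. Simultaneous Diophantine
  approximation of the \<open>c\<^sub>i\<close> yields such a relation with coefficients in \<open>\<nat>\<close>: the rounded
  combination is a lattice vector of norm less than 1, hence zero. Solving it for \<open>-x\<close> shows
  that the monoid contains \<open>-x\<close>.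
\<close>

lemma embed_R2_minus [simp]: "embed_R2 (- x) = - embed_R2 x"
  by (simp add: embed_R2_def)

text \<open>Subtracting \<open>q\<close> times the real relation leaves only the rounding errors, so
  the integer sum has absolute value at most (1/N) times the sum of the
  \<open>\<bar>a i\<bar>\<close>, which is below 1. An integer that small is 0.\<close>

lemma approx_int_relation:
  fixes a p :: "nat \<Rightarrow> int" and c :: "nat \<Rightarrow> real" and q :: real and N :: nat
  assumes rel: "(\<Sum>i<n. c i * of_int (a i)) = 0"
    and approx: "\<And>i. i < n \<Longrightarrow> \<bar>q * c i - of_int (p i)\<bar> < 1 / of_nat N"
    and N: "(\<Sum>i<n. \<bar>a i\<bar>) < int N"
  shows "(\<Sum>i<n. p i * a i) = 0"
proof -
  have Npos: "real N > 0"
    using order.strict_trans1[OF sum_nonneg[of "{..<n}" "\<lambda>i. \<bar>a i\<bar>"] N] by simp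
  have "of_int (\<Sum>i<n. p i * a i)
      = (\<Sum>i<n. of_int (p i) * real_of_int (a i)) - q * (\<Sum>i<n. c i * of_int (a i))"
    by (simp add: rel)
  also have "\<dots> = (\<Sum>i<n. (of_int (p i) - q * c i) * of_int (a i))"
    by (simp add: sum_distrib_left sum_subtractf[symmetric] algebra_simps)
  finally have "\<bar>of_int (\<Sum>i<n. p i * a i)\<bar>
      = \<bar>\<Sum>i<n. (of_int (p i) - q * c i) * real_of_int (a i)\<bar>"
    by simp
  also have "\<dots> \<le> (\<Sum>i<n. \<bar>(of_int (p i) - q * c i) * real_of_int (a i)\<bar>)"
    by (rule sum_abs)
  also have "\<dots> \<le> (\<Sum>i<n. (1 / N) * \<bar>real_of_int (a i)\<bar>)"
    unfolding abs_mult
    using approx by (intro sum_mono mult_right_mono) (auto simp: abs_minus_commute less_imp_le)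
  also have "\<dots> = of_int (\<Sum>i<n. \<bar>a i\<bar>) / N"
    by (simp add: sum_divide_distrib)
  also have "\<dots> < 1"
  proof -
    have "real_of_int (\<Sum>i<n. \<bar>a i\<bar>) < real_of_int (int N)"
      using N by (simp only: of_int_less_iff)
    then show ?thesis
      using Npos by simp
  qed
  finally show ?thesis
    by linarith
qed

text \<open>Rounding may send small coefficients to 0. The threshold \<open>c i \<ge> 1\<close>
  singles out those that certainly stay positive, so the caller can normalise the coefficient it
  wants to keep.\<close>

lemma nonneg_relation_nat:
  fixes s :: "nat \<Rightarrow> int \<times> int" and c :: "nat \<Rightarrow> real"
  assumes c: "\<And>i. i < n \<Longrightarrow> c i \<ge> 0"
    and rel: "(\<Sum>i<n. c i *\<^sub>R embed_R2 (s i)) = 0"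
  obtains m :: "nat \<Rightarrow> nat" where "(\<Sum>i<n. int (m i) * fst (s i)) = 0"
    and "(\<Sum>i<n. int (m i) * snd (s i)) = 0"
    and "\<And>i. i < n \<Longrightarrow> c i \<ge> 1 \<Longrightarrow> m i > 0"
proof -
  define f where "f = (\<Sum>i<n. \<bar>fst (s i)\<bar>)"
  define g where "g = (\<Sum>i<n. \<bar>snd (s i)\<bar>)"
  have fg: "f \<ge> 0" "g \<ge> 0"
    by (simp_all add: f_def g_def sum_nonneg)
  \<comment> \<open>\<open>N\<close> exceeds both coordinate sums, so a single Dirichlet
    approximation, with one \<open>q\<close> and one family \<open>p\<close>, settles both
    coordinates.\<close>
  define N where "N = Suc (nat (f + g))"
  have "N > 0"
    by (simp add: N_def)
  then obtain q p where q: "0 < q"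
    and p: "\<And>i. i < n \<Longrightarrow> \<bar>of_int q * c i - of_int (p i)\<bar> < 1 / real N"
    by (rule Dirichlet_approx_simult[where n = n and \<theta> = c]) (rule that; simp)
  have N: "f < int N" "g < int N" "1 / real N \<le> 1"
    using fg by (simp_all add: N_def)
  have "fst (\<Sum>i<n. c i *\<^sub>R embed_R2 (s i)) = 0" "snd (\<Sum>i<n. c i *\<^sub>R embed_R2 (s i)) = 0"
    using rel by simp_all
  then have "(\<Sum>i<n. c i * of_int (fst (s i))) = 0" "(\<Sum>i<n. c i * of_int (snd (s i))) = 0"
    by (simp_all add: fst_sum snd_sum embed_R2_def)
  then have eqs: "(\<Sum>i<n. p i * fst (s i)) = 0" "(\<Sum>i<n. p i * snd (s i)) = 0"
  proof -
    assume rel: "(\<Sum>i<n. c i * of_int (fst (s i))) = 0" "(\<Sum>i<n. c i * of_int (snd (s i))) = 0"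
    show "(\<Sum>i<n. p i * fst (s i)) = 0"
      by (rule approx_int_relation[OF rel(1) p N(1)[unfolded f_def]])
    show "(\<Sum>i<n. p i * snd (s i)) = 0"
      by (rule approx_int_relation[OF rel(2) p N(2)[unfolded g_def]])
  qed
  \<comment> \<open>The rounding error is below 1, so the integer \<open>p i\<close> exceeds -1 when
    \<open>c i \<ge> 0\<close>, and exceeds 0 when \<open>c i \<ge> 1\<close> because
    \<open>q \<ge> 1\<close>.\<close>
  have low: "real_of_int (p i) > of_int q * c i - 1" if "i < n" for i
    using p[OF that] N(3) by linarith
  have nonneg: "p i \<ge> 0" if "i < n" for i
  proof -
    have "of_int q * c i \<ge> 0"
      using q c[OF that] by simp
    then show ?thesis
      using low[OF that] by linarith
  qed
  have pos: "p i > 0" if "i < n" "c i \<ge> 1" for i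
  proof -
    have "1 * 1 \<le> of_int q * c i"
      using q that(2) by (intro mult_mono) auto
    then show ?thesis
      using low[OF that(1)] by linarith
  qed
  show thesis
    by (rule that[of "\<lambda>i. nat (p i)"]) (use eqs nonneg pos in auto)
qed

lemma submonoid_Z2_scale:
  assumes "submonoid M Z2" "x \<in> M"
  shows "(int k * fst x, int k * snd x) \<in> M"
proof -
  interpret submonoid M Z2 by fact
  have "0 \<in> M" "\<And>x y. x \<in> M \<Longrightarrow> y \<in> M \<Longrightarrow> x + y \<in> M"
    using one_closed m_closed by (auto simp: Z2_def)
  then show ?thesis
    using assms(2)
  proof (induction k)
    case (Suc k)
    have "(int (Suc k) * fst x, int (Suc k) * snd x) = x + (int k * fst x, int k * snd x)"
      by (simp add: prod_eq_iff algebra_simps)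
    then show ?case
      using Suc by simp
  qed (simp add: zero_prod_def)
qed

lemma submonoid_Z2_combination:
  fixes n :: nat
  assumes "submonoid M Z2" "\<And>i. i < n \<Longrightarrow> s i \<in> M"
  shows "(\<Sum>i<n. int (m i) * fst (s i), \<Sum>i<n. int (m i) * snd (s i)) \<in> M"
proof -
  interpret submonoid M Z2 by fact
  have M: "0 \<in> M" "\<And>x y. x \<in> M \<Longrightarrow> y \<in> M \<Longrightarrow> x + y \<in> M"
    using one_closed m_closed by (auto simp: Z2_def)
  show ?thesis
    using assms(2)
  proof (induction n)
    case (Suc n)
    have "(\<Sum>i<n. int (m i) * fst (s i), \<Sum>i<n. int (m i) * snd (s i))
        + (int (m n) * fst (s n), int (m n) * snd (s n)) \<in> M"
      using Suc submonoid_Z2_scale[OF assms(1)] by (intro M) auto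
    then show ?case
      by simp
  qed (use M in \<open>simp add: zero_prod_def\<close>)
qed

text \<open>One copy of \<open>s 0\<close> is taken out of the relation; what remains is a
  combination with coefficients in \<open>nat\<close>, hence in \<open>M\<close>, and equals
  \<open>- s 0\<close>. Positivity of \<open>m 0\<close> keeps the truncated subtraction
  exact.\<close>

lemma submonoid_Z2_minus_first:
  fixes n :: nat
  assumes M: "submonoid M Z2"
    and s: "\<And>i. i < n \<Longrightarrow> s i \<in> M"
    and n: "0 < n" and m: "m 0 > (0 :: nat)"
    and eqs: "(\<Sum>i<n. int (m i) * fst (s i)) = 0" "(\<Sum>i<n. int (m i) * snd (s i)) = 0"
  shows "- s 0 \<in> M"
proof -
  define m' where "m' = m(0 := m 0 - 1)"
  have split: "(\<Sum>i<n. int (m i) * h (s i)) = (\<Sum>i<n. int (m' i) * h (s i)) + h (s 0)"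
    for h :: "int \<times> int \<Rightarrow> int"
  proof -
    have "(\<Sum>i<n. int (m i) * h (s i))
        = (\<Sum>i<n. int (m' i) * h (s i) + (if i = 0 then h (s i) else 0))"
      using m by (intro sum.cong) (auto simp: m'_def algebra_simps of_nat_diff)
    also have "\<dots> = (\<Sum>i<n. int (m' i) * h (s i)) + h (s 0)"
      using n by (simp add: sum.distrib sum.delta)
    finally show ?thesis .
  qed
  have "- s 0 = (\<Sum>i<n. int (m' i) * fst (s i), \<Sum>i<n. int (m' i) * snd (s i))"
    using eqs split[of fst] split[of snd] by (simp add: prod_eq_iff)
  then show ?thesis
    using submonoid_Z2_combination[OF M, of n s m'] s by simp
qed

text \<open>This is \<open>convex_rel_interior_iff\<close> at the point 0, with
  \<open>e = 1 + d\<close>: every segment from a point of \<open>S\<close> to 0 can be prolonged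
  beyond 0 inside \<open>S\<close>.\<close>

lemma zero_in_rel_interior_iff:
  fixes S :: "'a::euclidean_space set"
  assumes "convex S" "S \<noteq> {}"
  shows "0 \<in> rel_interior S \<longleftrightarrow> (\<forall>x\<in>S. \<exists>d>0. - (d *\<^sub>R x) \<in> S)"
proof -
  have "(\<exists>e>1. (1 - e) *\<^sub>R x + e *\<^sub>R 0 \<in> S) \<longleftrightarrow> (\<exists>d>0. - (d *\<^sub>R x) \<in> S)" for x
  proof (intro iffI; elim exE conjE)
    fix e :: real assume "e > 1" "(1 - e) *\<^sub>R x + e *\<^sub>R 0 \<in> S"
    then show "\<exists>d>0. - (d *\<^sub>R x) \<in> S"
      by (intro exI[of _ "e - 1"]) (simp add: scaleR_minus_left[symmetric] del: scaleR_minus_left)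
  next
    fix d :: real assume "d > 0" "- (d *\<^sub>R x) \<in> S"
    then show "\<exists>e>1. (1 - e) *\<^sub>R x + e *\<^sub>R 0 \<in> S"
      by (intro exI[of _ "1 + d"]) simp
  qed
  then show ?thesis
    by (simp only: convex_rel_interior_iff[OF assms])
qed

lemma group_submonoid_Z2_iff:
  assumes "submonoid M Z2"
  shows "group (Z2\<lparr>carrier := M\<rparr>) \<longleftrightarrow> (\<forall>x\<in>M. - x \<in> M)"
proof
  assume "group (Z2\<lparr>carrier := M\<rparr>)"
  then interpret group "Z2\<lparr>carrier := M\<rparr>" .
  show "\<forall>x\<in>M. - x \<in> M"
  proof
    fix x assume "x \<in> M"
    then obtain y where "y \<in> M" "y + x = 0"
      using l_inv_ex[of x] unfolding Z2_def by auto
    then show "- x \<in> M"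
      by (simp add: eq_neg_iff_add_eq_0[symmetric])
  qed
next
  interpret submonoid M Z2 by fact
  assume "\<forall>x\<in>M. - x \<in> M"
  then show "group (Z2\<lparr>carrier := M\<rparr>)"
    using m_closed one_closed
    by (intro groupI) (auto simp: Z2_def add.assoc intro: bexI[where x = "- _"])
qed

text \<open>The geometric core, valid for any submonoid of the lattice; step sets and constraints
  enter only through \<open>submonoid_constrained_endpoints\<close>.\<close>

lemma zero_in_rel_interior_submonoid_Z2_iff:
  fixes M :: "(int \<times> int) set"
  assumes M: "submonoid M Z2"
  shows "0 \<in> rel_interior (convex hull (embed_R2 ` (M - {0})))
    \<longleftrightarrow> (\<forall>x\<in>M. - x \<in> M) \<and> M \<noteq> {0}"
proof -
  interpret submonoid M Z2 by fact
  have zero: "0 \<in> M"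
    using one_closed by (simp add: Z2_def)
  define S where "S = embed_R2 ` (M - {0})"
  show ?thesis
    unfolding S_def[symmetric]
  proof (intro iffI conjI ballI)
    assume int: "0 \<in> rel_interior (convex hull S)"
    \<comment> \<open>The relative interior of the empty hull is empty, which is how non-triviality
      is forced.\<close>
    then have ne: "S \<noteq> {}"
      by auto
    then show "M \<noteq> {0}"
      by (auto simp: S_def)
    fix x assume x: "x \<in> M"
    show "- x \<in> M"
    proof (cases "x = 0")
      case False
      then have "embed_R2 x \<in> convex hull S"
        using x by (auto simp: S_def intro: hull_inc)
      then obtain d where d: "d > 0" "- (d *\<^sub>R embed_R2 x) \<in> convex hull S"
        using int ne by (auto simp: zero_in_rel_interior_iff)
      obtain k u y where u: "\<forall>i\<in>{1..k::nat}. 0 \<le> u i \<and> y i \<in> S"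
        and y: "(\<Sum>i = 1..k. u i *\<^sub>R y i) = - (d *\<^sub>R embed_R2 x)"
        using d(2) unfolding convex_hull_indexed mem_Collect_eq
        by (elim exE conjE) (rule that)
      have "\<exists>z. z \<in> M \<and> y i = embed_R2 z" if "i \<in> {1..k}" for i
      proof -
        have "y i \<in> embed_R2 ` (M - {0})"
          using u that by (simp add: S_def)
        then obtain z where "z \<in> M - {0}" "y i = embed_R2 z"
          by (rule imageE)
        then show ?thesis
          by (intro exI[of _ z]) simp
      qed
      then obtain z where z: "\<And>i. i \<in> {1..k} \<Longrightarrow> z i \<in> M \<and> y i = embed_R2 (z i)"
        by metis
      \<comment> \<open>\<open>x\<close> goes to the free index 0, before the hull points at 1 to
        \<open>k\<close>. Dividing the relation by \<open>d\<close> gives \<open>x\<close> the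
        coefficient 1, just enough to guarantee \<open>m 0 > 0\<close> after rounding.\<close>
      define s where "s = (\<lambda>i. if i = 0 then x else z i)"
      define c where "c = (\<lambda>i. if i = 0 then 1 else u i / d)"
      have s: "s i \<in> M" if "i < Suc k" for i
        using that x z by (auto simp: s_def)
      have c: "c i \<ge> 0" if "i < Suc k" for i
        using that u d by (auto simp: c_def)
      have "(\<Sum>i<Suc k. c i *\<^sub>R embed_R2 (s i))
          = embed_R2 x + (\<Sum>i = 1..k. (u i / d) *\<^sub>R embed_R2 (z i))"
        unfolding sum.lessThan_Suc_shift sum.shift_bounds_cl_Suc_ivl
        by (simp add: s_def c_def sum.atLeast1_atMost_eq)
      also have "(\<Sum>i = 1..k. (u i / d) *\<^sub>R embed_R2 (z i)) = (1 / d) *\<^sub>R (\<Sum>i = 1..k. u i *\<^sub>R y i)"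
        unfolding scaleR_sum_right using z by (intro sum.cong) auto
      also have "\<dots> = - embed_R2 x"
        unfolding y using d by simp
      finally have "(\<Sum>i<Suc k. c i *\<^sub>R embed_R2 (s i)) = 0"
        by simp
      with c obtain m where m: "(\<Sum>i<Suc k. int (m i) * fst (s i)) = 0"
          "(\<Sum>i<Suc k. int (m i) * snd (s i)) = 0"
          "\<And>i. i < Suc k \<Longrightarrow> c i \<ge> 1 \<Longrightarrow> m i > 0"
        using nonneg_relation_nat[of "Suc k" c s] by blast
      have "- s 0 \<in> M"
        by (rule submonoid_Z2_minus_first[OF M s _ _ m(1,2)]) (use m(3)[of 0] in \<open>auto simp: c_def\<close>)
      then show ?thesis
        by (simp add: s_def)
    qed (use x in simp)
  next
    assume sym: "(\<forall>x\<in>M. - x \<in> M) \<and> M \<noteq> {0}"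
    then have ne: "S \<noteq> {}"
      using zero by (auto simp: S_def)
    have "uminus ` S \<subseteq> S"
    unfolding S_def image_image
    proof (intro image_subsetI; elim DiffE)
      fix x assume "x \<in> M" "x \<notin> {0}"
      then have "- x \<in> M - {0}"
        using sym by simp
      then have "embed_R2 (- x) \<in> embed_R2 ` (M - {0})"
        by (rule imageI)
      then show "- embed_R2 x \<in> embed_R2 ` (M - {0})"
        by simp
    qed
    \<comment> \<open>Negation is linear, so it commutes with taking hulls and the symmetry of
      \<open>S\<close> passes to its hull. The prolongation criterion then holds with
      \<open>d = 1\<close> everywhere.\<close>
    then have "uminus ` (convex hull S) \<subseteq> convex hull S"
      using convex_hull_linear_image[of "uminus :: real \<times> real \<Rightarrow> _" S] hull_mono[of "uminus ` S" S convex]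
      by (simp add: linear_uminus)
    then show "0 \<in> rel_interior (convex hull S)"
      using ne by (auto simp: zero_in_rel_interior_iff intro!: exI[of _ "1 :: real"])
  qed
qed

text \<open>Constrained words are closed under concatenation: a prefix of \<open>v @ w\<close> is a
  prefix of \<open>v\<close>, or all of \<open>v\<close> followed by a prefix of \<open>w\<close>,
  and then its sum adds two elements of \<open>C\<close>.\<close>

lemma submonoid_constrained_endpoints:
  assumes "submonoid C Z2"
  shows "submonoid (constrained_endpoints C X) Z2"
proof -
  interpret submonoid C Z2 by fact
  have C: "0 \<in> C" "\<And>x y. x \<in> C \<Longrightarrow> y \<in> C \<Longrightarrow> x + y \<in> C"
    using one_closed m_closed by (auto simp: Z2_def)
  have "[] \<in> constrained_words C X"
    using C by (simp add: constrained_words_def alpha_def)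
  then have zero: "0 \<in> constrained_endpoints C X"
    by (force simp: constrained_endpoints_def alpha_def)
  have append: "v @ w \<in> constrained_words C X"
    if "v \<in> constrained_words C X" "w \<in> constrained_words C X" for v w
    using that unfolding constrained_words_def
  proof (clarsimp simp: alpha_def)
    fix m
    assume v: "\<forall>m\<le>length v. sum_list (take m v) \<in> C"
      and w: "\<forall>m\<le>length w. sum_list (take m w) \<in> C"
      and m: "m \<le> length v + length w"
    show "sum_list (take m v) + sum_list (take (m - length v) w) \<in> C"
    proof (cases "m \<le> length v")
      case False
      then show ?thesis
        using v[rule_format, of "length v"] w m by (intro C) auto
    qed (use v in auto)
  qed
  have "x + y \<in> constrained_endpoints C X"
    if "x \<in> constrained_endpoints C X" "y \<in> constrained_endpoints C X" for x y
    using that append unfolding constrained_endpoints_def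
    by (force simp: alpha_def simp flip: sum_list_append)
  with zero show ?thesis
    by unfold_locales (auto simp: Z2_def)
qed

theorem proposition3p11:
  fixes X C :: "(int \<times> int) set"
  assumes "X \<subseteq> UNIV - {0}"
    and "submonoid C Z2"
  shows "group (Z2\<lparr>carrier := constrained_endpoints C X\<rparr>) \<and> constrained_endpoints C X \<noteq> {0}
    \<longleftrightarrow> 0 \<in> rel_interior (convex hull (embed_R2 ` (constrained_endpoints C X - {0})))"
  using submonoid_constrained_endpoints[OF assms(2), of X]
  by (simp add: group_submonoid_Z2_iff zero_in_rel_interior_submonoid_Z2_iff)

end
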